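(* There exists a basis $\{T_\alpha\}_\alpha$ of $\mathrm{QSym}$, indexed by integer compositions $\alpha$, such that for all compositions $\alpha\vDash m$ and $\beta\vDash n$, $$T_\alpha T_\beta=\sum_{v\in\overrightarrow{\mathrm{Sh}}(w^{\mathrm{Tie}}_\alpha,\,w^{\mathrm{Tie}}_\beta)}T_{\mathrm{Comp}(\mathrm{Tie}(v))}=\sum_{\gamma\vDash m+n}c^{\gamma}_{\alpha,\beta}\,T_\gamma,$$ where $c^\gamma_{\alpha,\beta}$ is the number of words $v$ with $\mathrm{Comp}(\mathrm{Tie}(v))=\gamma$ among the shifted shuffles of $w^{\mathrm{Tie}}_\alpha$ and $w^{\mathrm{Tie}}_\beta$.
   Context: $\mathrm{QSym}$ is the algebra of quasisymmetric functions over $\mathbb{Q}$. A word is a finite sequence of positive integers. For a word $v$ of length $n$, $\mathrm{Tie}(v)=\{i\in[n-1]:v_i=v_{i+1}\}$. A composition $\alpha=(\alpha_1,\dots,\alpha_k)\vDash n$ is a sequence of positive integers with sum $n$; $\mathrm{Set}(\alpha)=\{\alpha_1,\alpha_1+\alpha_2,\dots,\alpha_1+\dots+\alpha_{k-1}\}\subseteq[n-1]$, and $\mathrm{Comp}$ is the inverse bijection from subsets of $[n-1]$ to compositions of $n$: $\mathrm{Comp}(\{s_1<\dots<s_k\})=(s_1,s_2-s_1,\dots,s_k-s_{k-1},n-s_k)$. For a word $v$ of length $n$, $\mathrm{Comp}(\mathrm{Tie}(v))$ is taken as a composition of $n$. For $\alpha\vDash n$, the tie word $w^{\mathrm{Tie}}_\alpha=(w_1,\dots,w_n)$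 is the word with $w_1=1$ and, for $1\le i\le n-1$, $w_{i+1}=w_i$ if $i\in\mathrm{Set}(\alpha)$ and $w_{i+1}=w_i+1$ if $i\notin\mathrm{Set}(\alpha)$ (so $\mathrm{Tie}(w^{\mathrm{Tie}}_\alpha)=\mathrm{Set}(\alpha)$). The shifted shuffle $\overrightarrow{\mathrm{Sh}}(u,w)$ of words is the multiset of all interleavings of $u$ with $w[k]$, where $k$ is the largest letter of $u$ ($0$ if empty) and $w[k]$ is $w$ with $k$ added to every letter. The empty composition of $0$ corresponds to the empty word. *)

theory Defs
  imports Complex_Main "HOL-Library.Multiset" "HOL-Library.Poly_Mapping" "HOL-Library.FuncSet"
begin

section \<open>Formal power series in countably many commuting variables\<close>

text \<open>
  The variables \<open>x\<^sub>0, x\<^sub>1, x\<^sub>2, \<dots>\<close> are indexed by \<^typ>\<open>nat\<close> with its usual order, and a monomial is its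
  exponent vector.  A series is an arbitrary family of coefficients.
\<close>

type_synonym monomial = "nat \<Rightarrow>\<^sub>0 nat"

typedef 'a mps = "UNIV :: (monomial \<Rightarrow> 'a) set"
  morphisms mps_coeff Abs_mps ..

setup_lifting type_definition_mps

definition mdecomp :: "monomial \<Rightarrow> (monomial \<times> monomial) set" where
  "mdecomp m = {(a, b). a + b = m}"

lemma finite_monomials_below: "finite {a :: monomial. \<exists>b. a + b = m}"
proof -
  let ?K = "Poly_Mapping.keys m"
  let ?F = "\<lambda>a :: monomial. restrict (Poly_Mapping.lookup a) ?K"
  have "inj_on ?F {a. \<exists>b. a + b = m}"
  proof (rule inj_onI)
    fix a a' :: monomial
    assume "a \<in> {a. \<exists>b. a + b = m}" "a' \<in> {a. \<exists>b. a + b = m}" and eq: "?F a = ?F a'"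
    then obtain b b' where b: "a + b = m" "a' + b' = m" by blast
    show "a = a'"
    proof (rule poly_mapping_eqI)
      fix k
      show "Poly_Mapping.lookup a k = Poly_Mapping.lookup a' k"
      proof (cases "k \<in> ?K")
        case True
        then show ?thesis using fun_cong[OF eq, of k] by simp
      next
        case False
        then have "Poly_Mapping.lookup (a + b) k = 0" "Poly_Mapping.lookup (a' + b') k = 0"
          using b by (simp_all add: in_keys_iff)
        then show ?thesis by (simp add: lookup_add)
      qed
    qed
  qed
  moreover have "?F ` {a. \<exists>b. a + b = m} \<subseteq> Pi\<^sub>E ?K (\<lambda>k. {..Poly_Mapping.lookup m k})"
    by (auto simp: lookup_add)
  moreover have "finite (Pi\<^sub>E ?K (\<lambda>k. {..Poly_Mapping.lookup m k}))"
    by (intro finite_PiE) auto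
  ultimately show ?thesis
    by (meson finite_imageD finite_subset)
qed

lemma finite_mdecomp [simp]: "finite (mdecomp m)"
proof -
  have "mdecomp m \<subseteq> {a. \<exists>b. a + b = m} \<times> {b. \<exists>a. b + a = m}"
    by (auto simp: mdecomp_def) (metis add.commute)
  then show ?thesis
    using finite_monomials_below[of m] by (meson finite_SigmaI finite_subset)
qed

instantiation mps :: (comm_ring_1) comm_ring_1
begin

lift_definition zero_mps :: "'a mps" is "\<lambda>_. 0" .
lift_definition one_mps :: "'a mps" is "\<lambda>m. if m = 0 then 1 else 0" .
lift_definition plus_mps :: "'a mps \<Rightarrow> 'a mps \<Rightarrow> 'a mps" is "\<lambda>f g m. f m + g m" .
lift_definition minus_mps :: "'a mps \<Rightarrow> 'a mps \<Rightarrow> 'a mps" is "\<lambda>f g m. f m - g m" .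
lift_definition uminus_mps :: "'a mps \<Rightarrow> 'a mps" is "\<lambda>f m. - f m" .
lift_definition times_mps :: "'a mps \<Rightarrow> 'a mps \<Rightarrow> 'a mps"
  is "\<lambda>f g m. \<Sum>(a, b) \<in> mdecomp m. f a * g b" .

instance
proof
  fix f g h :: "'a mps"
  show "f * g * h = f * (g * h)"
  proof (transfer, rule ext)
    fix f g h :: "monomial \<Rightarrow> 'a" and m
    have "(\<Sum>(a, b)\<in>mdecomp m. (\<Sum>(a, b)\<in>mdecomp a. f a * g b) * h b) =
        (\<Sum>(p, q)\<in>Sigma (mdecomp m) (\<lambda>(a, b). mdecomp a). f (fst q) * g (snd q) * h (snd p))"
      by (subst sum.Sigma [symmetric]) (auto simp: sum_distrib_right case_prod_unfold)
    also have "\<dots> =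
        (\<Sum>(p, q)\<in>Sigma (mdecomp m) (\<lambda>(a, b). mdecomp b). f (fst p) * g (fst q) * h (snd q))"
      by (rule sum.reindex_bij_witness
          [where i = "\<lambda>(p, q). ((fst p + fst q, snd q), (fst p, fst q))"
             and j = "\<lambda>(p, q). ((fst q, snd q + snd p), (snd q, snd p))"])
         (auto simp: mdecomp_def add.assoc)
    also have "\<dots> = (\<Sum>(a, b)\<in>mdecomp m. f a * (\<Sum>(a, b)\<in>mdecomp b. g a * h b))"
      by (subst sum.Sigma [symmetric])
         (auto simp: sum_distrib_left case_prod_unfold mult.assoc)
    finally show "(\<Sum>(a, b)\<in>mdecomp m. (\<Sum>(a, b)\<in>mdecomp a. f a * g b) * h b) =
        (\<Sum>(a, b)\<in>mdecomp m. f a * (\<Sum>(a, b)\<in>mdecomp b. g a * h b))" .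
  qed
  show "f * g = g * f"
  proof (transfer, rule ext)
    fix f g :: "monomial \<Rightarrow> 'a" and m
    show "(\<Sum>(a, b)\<in>mdecomp m. f a * g b) = (\<Sum>(a, b)\<in>mdecomp m. g a * f b)"
      by (rule sum.reindex_bij_witness [where i = prod.swap and j = prod.swap])
         (auto simp: mdecomp_def add.commute mult.commute)
  qed
  show "1 * f = f"
  proof (transfer, rule ext)
    fix f :: "monomial \<Rightarrow> 'a" and m
    have "(\<Sum>(a, b)\<in>mdecomp m. (if a = 0 then 1 else 0) * f b) =
        (\<Sum>(a, b)\<in>{(0 :: monomial, m)}. (if a = 0 then 1 else 0) * f b)"
      by (rule sum.mono_neutral_right [OF finite_mdecomp]) (auto simp: mdecomp_def split: if_splits)
    then show "(\<Sum>(a, b)\<in>mdecomp m. (if a = 0 then 1 else 0) * f b) = f m" by simp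
  qed
  show "(f + g) * h = f * h + g * h"
    by (transfer, rule ext) (simp add: distrib_right sum.distrib case_prod_unfold)
  show "(0 :: 'a mps) \<noteq> 1"
    by transfer (metis zero_neq_one)
qed (transfer, simp add: algebra_simps fun_eq_iff)+

end

lift_definition mps_scale :: "'a::comm_ring_1 \<Rightarrow> 'a mps \<Rightarrow> 'a mps" is "\<lambda>c f m. c * f m" .

global_interpretation mps: vector_space "mps_scale :: rat \<Rightarrow> rat mps \<Rightarrow> rat mps"
  by unfold_locales (transfer, simp add: algebra_simps fun_eq_iff)+


section \<open>Compositions\<close>

text \<open>The empty list is the empty composition, the only composition of \<open>0\<close>.\<close>

definition is_composition :: "nat list \<Rightarrow> bool" where
  "is_composition \<alpha> \<longleftrightarrow> (\<forall>a \<in> set \<alpha>. 0 < a)"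

definition compositions :: "nat \<Rightarrow> nat list set" where
  "compositions n = {\<alpha>. is_composition \<alpha> \<and> sum_list \<alpha> = n}"

definition Set_of_comp :: "nat list \<Rightarrow> nat set" where
  "Set_of_comp \<alpha> = {sum_list (take j \<alpha>) | j. 1 \<le> j \<and> j < length \<alpha>}"

text \<open>
  For \<open>n = 0\<close> the difference formula would produce the list \<open>[0]\<close>, so the empty composition is
  singled out.
\<close>

definition Comp :: "nat \<Rightarrow> nat set \<Rightarrow> nat list" where
  "Comp n S = (if n = 0 then []
     else let s = sorted_list_of_set S in map2 (-) (s @ [n]) (0 # s))"


section \<open>Quasisymmetric functions\<close>

definition mdegree :: "monomial \<Rightarrow> nat" where
  "mdegree m = (\<Sum>i \<in> Poly_Mapping.keys m. Poly_Mapping.lookup m i)"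

text \<open>\<open>mono_of [i\<^sub>1, \<dots>, i\<^sub>k] [a\<^sub>1, \<dots>, a\<^sub>k]\<close> is the monomial with \<open>x\<^bsub>i\<^sub>j\<^esub>\<close> raised to the power \<open>a\<^sub>j\<close>.\<close>

definition mono_of :: "nat list \<Rightarrow> nat list \<Rightarrow> monomial" where
  "mono_of is \<alpha> = sum_list (map2 Poly_Mapping.single is \<alpha>)"

definition QSym :: "rat mps set" where
  "QSym = {f.
     (\<exists>d. \<forall>m. mps_coeff f m \<noteq> 0 \<longrightarrow> mdegree m \<le> d) \<and>
     (\<forall>\<alpha> is js. is_composition \<alpha> \<longrightarrow>
        sorted_wrt (<) is \<longrightarrow> sorted_wrt (<) js \<longrightarrow>
        length is = length \<alpha> \<longrightarrow> length js = length \<alpha> \<longrightarrow>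
        mps_coeff f (mono_of is \<alpha>) = mps_coeff f (mono_of js \<alpha>))}"


section \<open>Words, ties and shifted shuffles\<close>

text \<open>Positions in words are counted from \<open>1\<close>, list indices from \<open>0\<close>.\<close>

definition Tie :: "nat list \<Rightarrow> nat set" where
  "Tie v = {i. 1 \<le> i \<and> i < length v \<and> v ! (i - 1) = v ! i}"

text \<open>\<open>tie_letter S i\<close> is the letter \<open>w\<^bsub>i+1\<^esub>\<close> of the tie word of a composition with set \<open>S\<close>.\<close>

fun tie_letter :: "nat set \<Rightarrow> nat \<Rightarrow> nat" where
  "tie_letter S 0 = 1"
| "tie_letter S (Suc i) = (if Suc i \<in> S then tie_letter S i else tie_letter S i + 1)"

definition tie_word :: "nat list \<Rightarrow> nat list" where
  "tie_word \<alpha> = map (tie_letter (Set_of_comp \<alpha>)) [0..<sum_list \<alpha>]"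

text \<open>Unlike \<^const>\<open>shuffles\<close>, this keeps track of multiplicities.\<close>

fun shuffle_mset :: "'a list \<Rightarrow> 'a list \<Rightarrow> 'a list multiset" where
  "shuffle_mset [] w = {#w#}"
| "shuffle_mset u [] = {#u#}"
| "shuffle_mset (x # u) (y # w) =
     image_mset (Cons x) (shuffle_mset u (y # w)) + image_mset (Cons y) (shuffle_mset (x # u) w)"

definition max_letter :: "nat list \<Rightarrow> nat" where
  "max_letter u = Max (insert 0 (set u))"

definition shifted_shuffle :: "nat list \<Rightarrow> nat list \<Rightarrow> nat list multiset" where
  "shifted_shuffle u w = shuffle_mset u (map (\<lambda>x. x + max_letter u) w)"

definition tie_comp :: "nat list \<Rightarrow> nat list" where
  "tie_comp v = Comp (length v) (Tie v)"

definition tie_coeff :: "nat list \<Rightarrow> nat list \<Rightarrow> nat list \<Rightarrow> nat" where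
  "tie_coeff \<alpha> \<beta> \<gamma> =
     size {#v \<in># shifted_shuffle (tie_word \<alpha>) (tie_word \<beta>). tie_comp v = \<gamma>#}"

end

theory Submission
  imports Defs
begin

text \<open>
  For a composition \<open>\<delta> = (\<delta>\<^sub>1, \<dots>, \<delta>\<^sub>r)\<close> let \<open>E\<^sub>\<delta>\<close> be the sum over all \<open>i\<^sub>1 \<le> \<dots> \<le> i\<^sub>r\<close> of the monomials
  with factors \<open>x\<close> of index \<open>i\<^sub>j\<close> to the power \<open>\<delta>\<^sub>j\<close>, each divided by the product of \<open>k!\<close> over the
  maximal constant stretches of length \<open>k\<close> in \<open>i\<^sub>1, \<dots>, i\<^sub>r\<close> (Hoffman's exponential).  The factorials turn
  the quasi-shuffle product into the shuffle product, so \<open>E\<^sub>\<delta> E\<^sub>\<epsilon>\<close> is the sum of \<open>E\<^sub>\<sigma>\<close> over the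
  shuffles \<open>\<sigma>\<close> of \<open>\<delta>\<close> and \<open>\<epsilon>\<close>, and the \<open>E\<^sub>\<delta>\<close> are unitriangular over the monomial basis.

  Now let \<open>T\<^sub>\<alpha>\<close> be the sum of \<open>E\<^sub>\<delta>\<close> over all ways to cut the tie word of \<open>\<alpha>\<close> into constant segments, of
  lengths \<open>\<delta>\<close>.  A constant segment of a shuffle of two words with disjoint alphabets comes from one
  of the two words, so cutting such a shuffle is the same as shuffling the segments of two cut
  words; this gives the product rule.  The coarsest cut makes \<open>T\<close> unitriangular over \<open>E\<close>.
\<close>

section \<open>Shuffles\<close>

lemma shuffle_mset_Nil2 [simp]: "shuffle_mset u [] = {#u#}"
  by (cases u) auto

lemma shuffle_mset_commute: "shuffle_mset u w = shuffle_mset w u"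
  by (induction u w rule: shuffle_mset.induct) (simp_all add: add.commute)

lemma mset_in_shuffle_mset: "v \<in># shuffle_mset u w \<Longrightarrow> mset v = mset u + mset w"
  by (induction u w arbitrary: v rule: shuffle_mset.induct) auto

lemma
  assumes "v \<in># shuffle_mset u w"
  shows length_in_shuffle_mset: "length v = length u + length w"
    and set_in_shuffle_mset: "set v = set u \<union> set w"
  using mset_in_shuffle_mset[OF assms]
  by (metis size_mset size_union, metis set_mset_mset set_mset_union)

lemma sum_list_in_shuffle_mset:
  fixes u w :: "nat list"
  assumes "v \<in># shuffle_mset u w"
  shows "sum_list v = sum_list u + sum_list w"
  using mset_in_shuffle_mset[OF assms] by (metis sum_mset.union sum_mset_sum_list)

lemma size_shuffle_mset: "size (shuffle_mset u w) = (length u + length w) choose length u"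
  by (induction u w rule: shuffle_mset.induct) (simp_all add: add.commute)

section \<open>Shuffles and deconcatenation\<close>

definition shuffle_sum :: "('a list \<Rightarrow> 'b :: comm_monoid_add) \<Rightarrow> 'a list \<Rightarrow> 'a list \<Rightarrow> 'b" where
  "shuffle_sum g u w = (\<Sum>v\<in>#shuffle_mset u w. g v)"

lemma shuffle_sum_simps [simp]:
  "shuffle_sum g [] w = g w"
  "shuffle_sum g u [] = g u"
  "shuffle_sum g (x # u) (y # w) =
     shuffle_sum (\<lambda>v. g (x # v)) u (y # w) + shuffle_sum (\<lambda>v. g (y # v)) (x # u) w"
  by (simp_all add: shuffle_sum_def image_mset.compositionality o_def)

text \<open>This is convolution with respect to deconcatenation of words. Multiplying in one more
  variable, as in \<open>exp_poly\<close>, is such a convolution.\<close>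

definition convolve :: "('a list \<Rightarrow> 'b :: comm_semiring_1) \<Rightarrow> ('a list \<Rightarrow> 'b) \<Rightarrow> 'a list \<Rightarrow> 'b" where
  "convolve g h v = (\<Sum>i\<le>length v. g (take i v) * h (drop i v))"

lemma convolve_Nil [simp]: "convolve g h [] = g [] * h []"
  by (simp add: convolve_def)

lemma convolve_Cons [simp]:
  "convolve g h (x # v) = g [] * h (x # v) + convolve (\<lambda>z. g (x # z)) h v"
  unfolding convolve_def by (simp add: sum.atMost_Suc_shift del: sum.atMost_Suc)

lemma shuffle_sum_add:
  "shuffle_sum (\<lambda>v. g v + h v) u w = shuffle_sum g u w + shuffle_sum h u w"
  by (simp add: shuffle_sum_def sum_mset.distrib)

lemma shuffle_sum_cmult:
  fixes c :: "'b :: comm_semiring_1"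
  shows "shuffle_sum (\<lambda>v. c * h v) u w = c * shuffle_sum h u w"
  by (simp add: shuffle_sum_def sum_mset_distrib_left)

text \<open>Cutting a shuffle of \<open>u\<close> and \<open>w\<close> in two yields a shuffle of
  two prefixes and a shuffle of the two remaining suffixes: shuffling is compatible with
  deconcatenation. The induction varies \<open>g\<close>, which absorbs the first letter.\<close>

lemma shuffle_sum_convolve:
  fixes g h :: "'a list \<Rightarrow> 'b :: comm_semiring_1"
  shows "shuffle_sum (convolve g h) u w = (\<Sum>i\<le>length u. \<Sum>j\<le>length w.
    shuffle_sum g (take i u) (take j w) * shuffle_sum h (drop i u) (drop j w))"
proof (induction "length u + length w" arbitrary: u w g rule: less_induct)
  case less
  show ?case
  proof (cases u)
    case Nil
    then show ?thesis by (simp add: convolve_def)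
  next
    case u: (Cons x u')
    show ?thesis
    proof (cases w)
      case Nil
      then show ?thesis by (simp add: convolve_def)
    next
      case w: (Cons y w')
      let ?H = "\<lambda>i j. shuffle_sum h (drop i u) (drop j w)"
      let ?gx = "\<lambda>v. g (x # v)" and ?gy = "\<lambda>v. g (y # v)"
      have 1: "shuffle_sum (convolve ?gx h) u' w =
          (\<Sum>i\<le>length u'. \<Sum>j\<le>length w. shuffle_sum ?gx (take i u') (take j w) * ?H (Suc i) j)"
        using less[of u' w ?gx] by (simp add: u)
      have 2: "shuffle_sum (convolve ?gy h) u w' =
          (\<Sum>i\<le>length u. \<Sum>j\<le>length w'. shuffle_sum ?gy (take i u) (take j w') * ?H i (Suc j))"
        using less[of u w' ?gy] by (simp add: w)
      \<comment> \<open>The cut before the first letter gives the term with \<open>g []\<close>. Any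
        other cut puts the first letter, \<open>x\<close> or \<open>y\<close>, into the left
        factor.\<close>
      have "shuffle_sum (convolve g h) u w = g [] * ?H 0 0 +
          (shuffle_sum (convolve ?gx h) u' w + shuffle_sum (convolve ?gy h) u w')"
        by (simp add: u w shuffle_sum_add shuffle_sum_cmult algebra_simps)
      also have "\<dots> = (\<Sum>i\<le>length u. \<Sum>j\<le>length w. shuffle_sum g (take i u) (take j w) * ?H i j)"
        unfolding 1 2 by (simp add: u w sum.atMost_Suc_shift sum.distrib algebra_simps del: sum.atMost_Suc)
      finally show ?thesis .
    qed
  qed
qed

text \<open>Characters of the shuffle algebra with commutative target are closed under convolution.
  This lifts the product rule from one variable to finitely many.\<close>

lemma convolve_shuffle:
  fixes g h :: "'a list \<Rightarrow> 'b :: comm_semiring_1"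
  assumes "\<And>u w. g u * g w = shuffle_sum g u w" "\<And>u w. h u * h w = shuffle_sum h u w"
  shows "convolve g h u * convolve g h w = shuffle_sum (convolve g h) u w"
  unfolding shuffle_sum_convolve assms[symmetric] convolve_def sum_product
  by (simp add: mult_ac)

section \<open>Cuts into constant segments\<close>

text \<open>
  \<open>open_cuts x j v\<close> lists the cuts of \<open>v\<close> preceded by a segment of \<open>j\<close> letters \<open>x\<close> that may still grow;
  a cut is represented by its list of segment lengths.
\<close>

fun open_cuts :: "'a \<Rightarrow> nat \<Rightarrow> 'a list \<Rightarrow> nat list multiset" where
  "open_cuts x j [] = {#[j]#}"
| "open_cuts x j (y # v) = image_mset (Cons j) (open_cuts y 1 v) +
     (if x = y then open_cuts x (Suc j) v else {#})"

fun cuts :: "'a list \<Rightarrow> nat list multiset" where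
  "cuts [] = {#[]#}"
| "cuts (x # v) = open_cuts x 1 v"

text \<open>Either the open segment stops at \<open>j\<close> letters and \<open>v\<close> is cut
  freely, or it absorbs the first letter of \<open>v\<close>, which must then be \<open>x\<close>.
  Empty and nonempty \<open>v\<close> are treated uniformly.\<close>

lemma sum_open_cuts:
  "(\<Sum>\<delta>\<in>#open_cuts x j v. g \<delta>) = (\<Sum>\<delta>\<in>#cuts v. g (j # \<delta>)) +
    (if v \<noteq> [] \<and> hd v = x then \<Sum>\<delta>\<in>#open_cuts x (Suc j) (tl v). g \<delta> else 0)"
  by (cases v) (auto simp: image_mset.compositionality o_def)

lemma open_cuts_nonempty: "\<delta> \<in># open_cuts x j v \<Longrightarrow> \<delta> \<noteq> []"
  by (induction x j v rule: open_cuts.induct) (auto split: if_splits)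

text \<open>The open segment can only grow by letters of \<open>u\<close>, because \<open>x\<close>
  does not occur in \<open>w\<close>. So it stays in front as \<open>hd \<delta>\<close>, and only
  the later segments of \<open>u\<close> are shuffled with those of \<open>w\<close>. The first
  assumption is the cut rule for suffixes of \<open>u\<close>, to be supplied by an outer
  induction.\<close>

lemma sum_open_cuts_shuffle:
  fixes f :: "nat list \<Rightarrow> 'b :: comm_monoid_add"
  assumes "\<And>i f :: nat list \<Rightarrow> 'b. (\<Sum>v\<in>#shuffle_mset (drop i u) w. \<Sum>\<delta>\<in>#cuts v. f \<delta>) =
      (\<Sum>\<delta>\<in>#cuts (drop i u). \<Sum>\<epsilon>\<in>#cuts w. \<Sum>\<sigma>\<in>#shuffle_mset \<delta> \<epsilon>. f \<sigma>)"
    and "x \<notin> set w"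
  shows "(\<Sum>v\<in>#shuffle_mset u w. \<Sum>\<delta>\<in>#open_cuts x j v. f \<delta>) =
      (\<Sum>\<delta>\<in>#open_cuts x j u. \<Sum>\<epsilon>\<in>#cuts w. \<Sum>\<sigma>\<in>#shuffle_mset (tl \<delta>) \<epsilon>. f (hd \<delta> # \<sigma>))"
  using assms
proof (induction u arbitrary: j)
  case Nil
  then show ?case
    by (simp add: sum_open_cuts[of _ x j w]) auto
next
  case (Cons a u)
  have "(\<Sum>v\<in>#shuffle_mset (a # u) w. \<Sum>\<delta>\<in>#open_cuts x j v. f \<delta>) =
      (\<Sum>v\<in>#shuffle_mset (a # u) w. \<Sum>\<delta>\<in>#cuts v. f (j # \<delta>)) +
      (\<Sum>v\<in>#shuffle_mset (a # u) w.
        if v \<noteq> [] \<and> hd v = x then \<Sum>\<delta>\<in>#open_cuts x (Suc j) (tl v). f \<delta> else 0)"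
    unfolding sum_open_cuts[of _ x j] sum_mset.distrib ..
  also have "(\<Sum>v\<in>#shuffle_mset (a # u) w. \<Sum>\<delta>\<in>#cuts v. f (j # \<delta>)) =
      (\<Sum>\<delta>\<in>#cuts (a # u). \<Sum>\<epsilon>\<in>#cuts w. \<Sum>\<sigma>\<in>#shuffle_mset \<delta> \<epsilon>. f (j # \<sigma>))"
    using Cons.prems(1)[where i = 0] unfolding drop_0 .
  \<comment> \<open>A shuffle starting with a letter of \<open>w\<close> cannot extend the segment,
    so only those starting with \<open>a\<close> remain.\<close>
  also have "(\<Sum>v\<in>#shuffle_mset (a # u) w.
        if v \<noteq> [] \<and> hd v = x then \<Sum>\<delta>\<in>#open_cuts x (Suc j) (tl v). f \<delta> else 0) =
      (if a = x then \<Sum>v\<in>#shuffle_mset u w. \<Sum>\<delta>\<in>#open_cuts x (Suc j) v. f \<delta> else 0)"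
    using Cons.prems(2) by (cases w) (auto simp: image_mset.compositionality o_def)
  also have "(\<Sum>v\<in>#shuffle_mset u w. \<Sum>\<delta>\<in>#open_cuts x (Suc j) v. f \<delta>) =
      (\<Sum>\<delta>\<in>#open_cuts x (Suc j) u. \<Sum>\<epsilon>\<in>#cuts w. \<Sum>\<sigma>\<in>#shuffle_mset (tl \<delta>) \<epsilon>. f (hd \<delta> # \<sigma>))"
  proof (rule Cons.IH)
    fix i and f :: "nat list \<Rightarrow> 'b"
    show "(\<Sum>v\<in>#shuffle_mset (drop i u) w. \<Sum>\<delta>\<in>#cuts v. f \<delta>) =
      (\<Sum>\<delta>\<in>#cuts (drop i u). \<Sum>\<epsilon>\<in>#cuts w. \<Sum>\<sigma>\<in>#shuffle_mset \<delta> \<epsilon>. f \<sigma>)"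
      using Cons.prems(1)[where i = "Suc i"] unfolding drop_Suc_Cons .
  qed (fact Cons.prems(2))
  finally show ?case
    unfolding sum_open_cuts[of _ x j "a # u"] by simp
qed

text \<open>The first letter of a shuffle decides which word owns its first segment.
  \<open>sum_open_cuts_shuffle\<close> follows that segment to its end; what remains is a shorter
  instance.\<close>

lemma sum_cuts_shuffle:
  fixes f :: "nat list \<Rightarrow> 'b :: comm_monoid_add"
  assumes "set u \<inter> set w = {}"
  shows "(\<Sum>v\<in>#shuffle_mset u w. \<Sum>\<delta>\<in>#cuts v. f \<delta>) =
      (\<Sum>\<delta>\<in>#cuts u. \<Sum>\<epsilon>\<in>#cuts w. \<Sum>\<sigma>\<in>#shuffle_mset \<delta> \<epsilon>. f \<sigma>)"
  using assms
proof (induction "length u + length w" arbitrary: u w f rule: less_induct)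
  case less
  show ?case
  proof (cases u)
    case Nil
    then show ?thesis by simp
  next
    case u: (Cons x u')
    show ?thesis
    proof (cases w)
      case Nil
      then show ?thesis by simp
    next
      case w: (Cons y w')
      have disj: "set (drop i u') \<inter> set w = {}" "set (drop i w') \<inter> set u = {}" for i
        using less.prems set_drop_subset[of i u'] set_drop_subset[of i w'] by (auto simp: u w)
      have 1: "(\<Sum>v\<in>#shuffle_mset u' w. \<Sum>\<delta>\<in>#open_cuts x 1 v. f \<delta>) =
          (\<Sum>\<delta>\<in>#cuts u. \<Sum>\<epsilon>\<in>#cuts w. \<Sum>\<sigma>\<in>#shuffle_mset (tl \<delta>) \<epsilon>. f (hd \<delta> # \<sigma>))"
        unfolding u cuts.simps
        by (rule sum_open_cuts_shuffle[OF less.hyps]) (use less.prems disj(1) in \<open>auto simp: u w\<close>)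
      \<comment> \<open>The same argument with the two words exchanged, for shuffles whose first
        segment belongs to \<open>w\<close>.\<close>
      have "(\<Sum>v\<in>#shuffle_mset w' u. \<Sum>\<delta>\<in>#open_cuts y 1 v. f \<delta>) =
          (\<Sum>\<epsilon>\<in>#cuts w. \<Sum>\<delta>\<in>#cuts u. \<Sum>\<sigma>\<in>#shuffle_mset (tl \<epsilon>) \<delta>. f (hd \<epsilon> # \<sigma>))"
        unfolding w cuts.simps
        by (rule sum_open_cuts_shuffle[OF less.hyps]) (use less.prems disj(2) in \<open>auto simp: u w\<close>)
      then have 2: "(\<Sum>v\<in>#shuffle_mset u w'. \<Sum>\<delta>\<in>#open_cuts y 1 v. f \<delta>) =
          (\<Sum>\<delta>\<in>#cuts u. \<Sum>\<epsilon>\<in>#cuts w. \<Sum>\<sigma>\<in>#shuffle_mset \<delta> (tl \<epsilon>). f (hd \<epsilon> # \<sigma>))"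
        by (subst sum_mset.swap) (simp add: shuffle_mset_commute)
      \<comment> \<open>On the side of the cuts, the same case distinction: a shuffle of two
        nonempty cuts starts with one of their heads.\<close>
      have 3: "(\<Sum>\<sigma>\<in>#shuffle_mset \<delta> \<epsilon>. f \<sigma>) = (\<Sum>\<sigma>\<in>#shuffle_mset (tl \<delta>) \<epsilon>. f (hd \<delta> # \<sigma>)) +
          (\<Sum>\<sigma>\<in>#shuffle_mset \<delta> (tl \<epsilon>). f (hd \<epsilon> # \<sigma>))"
        if "\<delta> \<in># cuts u" "\<epsilon> \<in># cuts w" for \<delta> \<epsilon>
      proof -
        have "\<delta> \<noteq> []" "\<epsilon> \<noteq> []"
          using that by (auto simp: u w dest: open_cuts_nonempty)
        then show ?thesis
          by (cases \<delta>; cases \<epsilon>) (simp_all add: image_mset.compositionality o_def)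
      qed
      have "(\<Sum>v\<in>#shuffle_mset u w. \<Sum>\<delta>\<in>#cuts v. f \<delta>) =
          (\<Sum>v\<in>#shuffle_mset u' w. \<Sum>\<delta>\<in>#open_cuts x 1 v. f \<delta>) +
          (\<Sum>v\<in>#shuffle_mset u w'. \<Sum>\<delta>\<in>#open_cuts y 1 v. f \<delta>)"
        by (simp add: u w image_mset.compositionality o_def)
      also have "\<dots> = (\<Sum>\<delta>\<in>#cuts u. \<Sum>\<epsilon>\<in>#cuts w. \<Sum>\<sigma>\<in>#shuffle_mset \<delta> \<epsilon>. f \<sigma>)"
        unfolding 1 2 sum_mset.distrib[symmetric]
        by (intro arg_cong[of _ _ sum_mset] image_mset_cong 3[symmetric])
      finally show ?thesis .
    qed
  qed
qed

lemma open_cuts_composition: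
  assumes "\<delta> \<in># open_cuts x j v" "j > 0"
  shows "is_composition \<delta> \<and> sum_list \<delta> = j + length v"
  using assms
  by (induction x j v arbitrary: \<delta> rule: open_cuts.induct)
     (fastforce simp: is_composition_def split: if_splits)+

lemma cuts_in_compositions:
  assumes "\<delta> \<in># cuts v"
  shows "\<delta> \<in> compositions (length v)"
proof (cases v)
  case Nil
  with assms show ?thesis by (simp add: compositions_def is_composition_def)
next
  case (Cons x v')
  with assms show ?thesis
    using open_cuts_composition[of \<delta> x 1 v'] by (simp add: compositions_def)
qed

section \<open>Cuts depend only on length and ties\<close>

lemma Tie_Cons_Cons:
  "Tie (x # y # v) = (if x = y then {1} else {}) \<union> Suc ` Tie (y # v)"
proof (rule set_eqI)
  fix i
  show "i \<in> Tie (x # y # v) \<longleftrightarrow> i \<in> (if x = y then {1} else {}) \<union> Suc ` Tie (y # v)"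
  proof (cases i)
    case 0
    then show ?thesis by (simp add: Tie_def)
  next
    case (Suc k)
    then show ?thesis
      by (cases k) (auto simp: Tie_def image_iff nth_Cons split: nat.splits)
  qed
qed

text \<open>The recursion for cuts only asks whether adjacent letters agree, never which letters
  they are. Hence a word may be replaced by any other with the same ties.\<close>

lemma open_cuts_cong:
  assumes "length v = length v'" "Tie (x # v) = Tie (x' # v')"
  shows "open_cuts x j v = open_cuts x' j v'"
  using assms
proof (induction v v' arbitrary: x x' j rule: list_induct2)
  case Nil
  then show ?case by simp
next
  case (Cons y v y' v')
  \<comment> \<open>Ties are counted from 1, so after the shift they start at 2. Position 1 thus
    separates the comparison of the first two letters from the rest.\<close>
  have 1: "Suc 0 \<notin> Suc ` Tie z" for z by (auto simp: Tie_def)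
  have "Suc 0 \<in> Tie (x # y # v) \<longleftrightarrow> Suc 0 \<in> Tie (x' # y' # v')"
    "Tie (x # y # v) - {Suc 0} = Tie (x' # y' # v') - {Suc 0}"
    using Cons.prems by simp_all
  then have eq: "x = y \<longleftrightarrow> x' = y'" and tie: "Suc ` Tie (y # v) = Suc ` Tie (y' # v')"
    using 1 by (auto simp: Tie_Cons_Cons Un_Diff split: if_splits)
  have "Tie (y # v) = Tie (y' # v')"
    using tie by (simp add: inj_image_eq_iff)
  with eq show ?case
    by (auto simp: Cons.IH[of y y'])
qed

lemma cuts_cong:
  assumes "length v = length v'" "Tie v = Tie v'"
  shows "cuts v = cuts v'"
  using assms by (cases v; cases v') (auto intro: open_cuts_cong)

lemma Tie_map_inj: "inj_on f (set v) \<Longrightarrow> Tie (map f v) = Tie v"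
  by (auto simp: Tie_def inj_on_eq_iff)

section \<open>Words with a prescribed coarsest cut\<close>

fun run_word :: "nat \<Rightarrow> nat list \<Rightarrow> nat list" where
  "run_word x [] = []"
| "run_word x (a # \<delta>) = replicate a x @ run_word (Suc x) \<delta>"

lemma length_run_word [simp]: "length (run_word x \<delta>) = sum_list \<delta>"
  by (induction \<delta> arbitrary: x) auto

text \<open>Absorbing every equal letter gives the coarsest cut. Any other cut also splits inside
  some run and so has more segments; these cuts form \<open>R\<close>.\<close>

lemma open_cuts_run_word:
  assumes "is_composition \<delta>"
  shows "\<exists>R. open_cuts x j (replicate a x @ run_word (Suc x) \<delta>) = add_mset ((j + a) # \<delta>) R \<and>
    (\<forall>\<epsilon>\<in>#R. Suc (length \<delta>) < length \<epsilon>)"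
  using assms
proof (induction \<delta> arbitrary: x j a)
  case Nil
  show ?case
  proof (induction a arbitrary: j)
    case 0
    then show ?case by simp
  next
    case (Suc a)
    from Suc[of "Suc j"] Suc[of 1] show ?case by force
  qed
next
  case (Cons b \<delta>)
  \<comment> \<open>As \<open>b\<close> is positive, the next run has a first letter, which differs
    from \<open>x\<close> and opens a new segment; \<open>b'\<close> letters of that run are
    left.\<close>
  from Cons.prems obtain b' where b: "b = Suc b'"
    by (auto simp: is_composition_def gr0_conv_Suc)
  show ?case
  proof (induction a arbitrary: j)
    case 0
    have "is_composition \<delta>" using Cons.prems by (simp add: is_composition_def)
    from Cons.IH[OF this, of "Suc x" 1 b'] show ?case by (force simp: b)
  next
    case (Suc a)
    from Suc[of "Suc j"] Suc[of 1] show ?case by force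
  qed
qed

lemma cuts_run_word:
  assumes "is_composition \<delta>"
  obtains R where "cuts (run_word x \<delta>) = add_mset \<delta> R" "\<And>\<epsilon>. \<epsilon> \<in># R \<Longrightarrow> length \<delta> < length \<epsilon>"
proof (cases \<delta>)
  case Nil
  then show ?thesis using that[of "{#}"] by simp
next
  case (Cons a \<delta>')
  then obtain a' where "a = Suc a'" "is_composition \<delta>'"
    using assms by (auto simp: is_composition_def gr0_conv_Suc)
  then show ?thesis
    using open_cuts_run_word[of \<delta>' x 1 a'] that by (auto simp: Cons)
qed

section \<open>Compositions and tie words\<close>

text \<open>The differences telescope. Sortedness keeps the subtraction on natural numbers from
  truncating.\<close>

lemma sum_list_take_diffs:
  fixes s :: "nat list"
  assumes "sorted (a # s)" "j \<le> length s"
  shows "sum_list (take j (map2 (-) s (a # butlast s))) = (if j = 0 then 0 else s ! (j - 1) - a)"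
  using assms
proof (induction s arbitrary: a j)
  case Nil
  then show ?case by simp
next
  case (Cons b s)
  show ?case
  proof (cases j)
    case 0
    then show ?thesis by simp
  next
    case (Suc i)
    show ?thesis
    proof (cases "s = []")
      case True
      then show ?thesis using Suc Cons.prems by simp
    next
      case False
      have "b \<le> s ! (i - 1)" if "i \<noteq> 0"
        using Cons.prems Suc that nth_mem[of "i - 1" s] by auto
      then show ?thesis
        using Cons.IH[of b i] Cons.prems Suc False by (auto simp: nth_Cons split: nat.splits)
    qed
  qed
qed

context
  fixes n :: nat and S :: "nat set"
  assumes S: "S \<subseteq> {1..<n}" and n: "n > 0"
begin

private abbreviation (input) "s \<equiv> sorted_list_of_set S"

private lemma s: "finite S" "set s = S" "sorted (0 # s @ [n])" "sorted_wrt (<) (0 # s @ [n])"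
proof -
  show fin: "finite S" using S finite_subset by blast
  then show "set s = S" by simp
  with S n strict_sorted_list_of_set[of S] show *: "sorted_wrt (<) (0 # s @ [n])"
    by (auto simp: sorted_wrt_append)
  then show "sorted (0 # s @ [n])"
    by (metis strict_sorted_iff)
qed

text \<open>Reading \<open>s\<close> as \<open>butlast (s @ [n])\<close> brings \<open>Comp\<close>
  into the form of the telescoping lemma, with starting value 0.\<close>

private lemma Comp_eq: "Comp n S = map2 (-) (s @ [n]) (0 # butlast (s @ [n]))"
  using n by (simp add: Comp_def Let_def)

private lemma take_Comp:
  assumes "1 \<le> j" "j \<le> Suc (length s)"
  shows "sum_list (take j (Comp n S)) = (s @ [n]) ! (j - 1)"
  using sum_list_take_diffs[OF s(3), of j] assms by (simp only: Comp_eq) simp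

private lemma length_Comp: "length (Comp n S) = Suc (length s)"
  using n by (simp add: Comp_def Let_def)

text \<open>By telescoping, the partial sums are the entries of \<open>s @ [n]\<close>; the bound
  \<open>j < length \<alpha>\<close> in \<open>Set_of_comp\<close> leaves out the last one,
  \<open>n\<close>.\<close>

lemma Set_of_comp_Comp_pos: "Set_of_comp (Comp n S) = S"
proof -
  have "Set_of_comp (Comp n S) = (\<lambda>j. (s @ [n]) ! (j - 1)) ` {1..length s}"
    unfolding Set_of_comp_def length_Comp using take_Comp by force
  also have "\<dots> = (\<lambda>j. s ! j) ` {..<length s}"
  proof -
    have "{1..length s} = Suc ` {..<length s}" by (rule image_Suc_lessThan[symmetric])
    then show ?thesis by (simp only: image_image) (simp add: nth_append)
  qed
  also have "\<dots> = S"
    using s(2) by (metis lessThan_atLeast0 list.set_map map_nth set_upt)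
  finally show ?thesis .
qed

lemma Comp_in_compositions_pos: "Comp n S \<in> compositions n"
proof -
  have "sum_list (take (Suc (length s)) (Comp n S)) = n"
    using take_Comp[of "Suc (length s)"] by (simp only: diff_Suc_1 nth_append_length)
  then have "sum_list (Comp n S) = n" using length_Comp by simp
  moreover have "0 < a" if "a \<in> set (Comp n S)" for a
  proof -
    from that obtain i where i: "i < Suc (length s)" "a = Comp n S ! i"
      by (auto simp: in_set_conv_nth length_Comp)
    have "a = (0 # s @ [n]) ! Suc i - (0 # s @ [n]) ! i"
      using i by (simp add: Comp_eq nth_append nth_Cons split: nat.splits)
    moreover have "(0 # s @ [n]) ! i < (0 # s @ [n]) ! Suc i"
      using sorted_wrt_nth_less[OF s(4), of i "Suc i"] i by simp
    ultimately show ?thesis by simp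
  qed
  ultimately show ?thesis by (simp add: compositions_def is_composition_def)
qed

end

lemma Set_of_comp_subset:
  assumes "is_composition \<alpha>"
  shows "Set_of_comp \<alpha> \<subseteq> {1..<sum_list \<alpha>}"
proof
  fix t assume "t \<in> Set_of_comp \<alpha>"
  then obtain j where j: "t = sum_list (take j \<alpha>)" "1 \<le> j" "j < length \<alpha>"
    by (auto simp: Set_of_comp_def)
  have pos: "0 < sum_list xs" if "xs \<noteq> []" "set xs \<subseteq> set \<alpha>" for xs
    using that assms by (cases xs) (auto simp: is_composition_def)
  have "0 < t"
    unfolding j by (rule pos) (use j in \<open>auto dest: in_set_takeD\<close>)
  moreover have "0 < sum_list (drop j \<alpha>)"
    by (rule pos) (use j in \<open>auto dest: in_set_dropD\<close>)
  moreover have "t + sum_list (drop j \<alpha>) = sum_list \<alpha>"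
    unfolding j by (metis append_take_drop_id sum_list_append)
  ultimately show "t \<in> {1..<sum_list \<alpha>}" by simp
qed

lemma length_tie_word [simp]: "length (tie_word \<alpha>) = sum_list \<alpha>"
  by (simp add: tie_word_def)

lemma Tie_tie_word:
  assumes "is_composition \<alpha>"
  shows "Tie (tie_word \<alpha>) = Set_of_comp \<alpha>"
proof -
  have "i \<in> Tie (tie_word \<alpha>) \<longleftrightarrow> i \<in> {1..<sum_list \<alpha>} \<and> i \<in> Set_of_comp \<alpha>" for i
    by (cases i) (auto simp: Tie_def tie_word_def split: if_splits)
  then show ?thesis using Set_of_comp_subset[OF assms] by auto
qed

lemma Tie_subset: "Tie v \<subseteq> {1..<length v}"
  by (auto simp: Tie_def)

lemma tie_comp_in_compositions: "tie_comp v \<in> compositions (length v)"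
proof (cases "v = []")
  case True
  then show ?thesis by (simp add: tie_comp_def Comp_def compositions_def is_composition_def)
next
  case False
  then show ?thesis
    unfolding tie_comp_def using Comp_in_compositions_pos[OF Tie_subset] by simp
qed

text \<open>The tie word of the composition of \<open>v\<close> is a stand-in for \<open>v\<close>
  with the same ties. The empty word is separate because \<open>Comp\<close> treats
  \<open>n = 0\<close> separately.\<close>

lemma Tie_tie_word_tie_comp: "Tie (tie_word (tie_comp v)) = Tie v"
proof (cases "v = []")
  case True
  then show ?thesis by (simp add: tie_comp_def Comp_def tie_word_def)
next
  case False
  have "is_composition (tie_comp v)"
    using tie_comp_in_compositions by (simp add: compositions_def)
  then have "Tie (tie_word (tie_comp v)) = Set_of_comp (tie_comp v)"
    by (rule Tie_tie_word)
  also have "\<dots> = Tie v"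
    unfolding tie_comp_def using Set_of_comp_Comp_pos[OF Tie_subset] False by simp
  finally show ?thesis .
qed

lemma length_le_sum_list: "is_composition \<alpha> \<Longrightarrow> length \<alpha> \<le> sum_list \<alpha>"
  by (induction \<alpha>) (auto simp: is_composition_def)

lemma finite_compositions: "finite (compositions n)"
proof -
  have "a \<le> sum_list \<alpha>" if "a \<in> set \<alpha>" for a :: nat and \<alpha>
    using that by (simp add: member_le_sum_list)
  then have "compositions n \<subseteq> {\<alpha>. set \<alpha> \<subseteq> {..n} \<and> length \<alpha> \<le> n}"
    using length_le_sum_list by (force simp: compositions_def)
  then show ?thesis
    using finite_lists_length_le[of "{..n}" n] finite_subset by blast
qed

section \<open>The exponential basis\<close>

definition monom_series :: "'a::comm_ring_1 \<Rightarrow> monomial \<Rightarrow> 'a mps" where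
  "monom_series c a = Abs_mps (\<lambda>m. if m = a then c else 0)"

lemma mps_coeff_simps [simp]:
  "mps_coeff 0 m = 0"
  "mps_coeff 1 m = (if m = 0 then 1 else 0)"
  "mps_coeff (f + g) m = mps_coeff f m + mps_coeff g m"
  "mps_coeff (mps_scale c f) m = c * mps_coeff f m"
  "mps_coeff (monom_series c a) m = (if m = a then c else 0)"
  by (simp_all add: zero_mps.rep_eq one_mps.rep_eq plus_mps.rep_eq mps_scale.rep_eq
      monom_series_def Abs_mps_inverse)

lemma mps_coeff_times: "mps_coeff (f * g) m = (\<Sum>(a, b)\<in>mdecomp m. mps_coeff f a * mps_coeff g b)"
  by transfer simp

lemma mps_eqI: "(\<And>m. mps_coeff f m = mps_coeff g m) \<Longrightarrow> f = g"
  by transfer auto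

lemma mps_coeff_sum: "mps_coeff (\<Sum>i\<in>I. f i) m = (\<Sum>i\<in>I. mps_coeff (f i) m)"
  by (induction I rule: infinite_finite_induct) auto

lemma mps_coeff_sum_mset: "mps_coeff (\<Sum>i\<in>#I. f i) m = (\<Sum>i\<in>#I. mps_coeff (f i) m)"
  by (induction I) auto

lemma mps_coeff_monom_series_times:
  "mps_coeff (monom_series c a * f) m = (if \<exists>b. a + b = m then c * mps_coeff f (m - a) else 0)"
proof -
  \<comment> \<open>Only the decomposition with first factor \<open>a\<close> contributes, and
    cancellation makes its second factor \<open>m - a\<close>. The intersection is empty if
    \<open>a\<close> does not divide \<open>m\<close>.\<close>
  have "mps_coeff (monom_series c a * f) m =
      (\<Sum>(a', b)\<in>mdecomp m \<inter> {(a, m - a)}. mps_coeff (monom_series c a) a' * mps_coeff f b)"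
    unfolding mps_coeff_times
    by (rule sum.mono_neutral_right) (auto simp: mdecomp_def finite_mdecomp[unfolded mdecomp_def] split: if_splits)
  also have "mdecomp m \<inter> {(a, m - a)} = (if \<exists>b. a + b = m then {(a, m - a)} else {})"
    by (auto simp: mdecomp_def)
  finally show ?thesis by simp
qed

text \<open>This is the exponential in the single variable with index \<open>k\<close>: all indices
  coincide and form one stretch, hence one monomial and one factorial.\<close>

definition level_series :: "nat \<Rightarrow> nat list \<Rightarrow> rat mps" where
  "level_series k \<delta> = monom_series (1 / fact (length \<delta>)) (Poly_Mapping.single k (sum_list \<delta>))"

text \<open>All shuffles have the same length and the same sum, so they contribute equal monomials.
  Their number is a binomial coefficient, which turns \<open>1 / fact (p + q)\<close> into
  \<open>1 / (fact p * fact q)\<close>.\<close>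

lemma level_series_shuffle:
  "level_series k \<delta> * level_series k \<epsilon> = shuffle_sum (level_series k) \<delta> \<epsilon>"
proof (rule mps_eqI)
  fix m
  let ?a = "Poly_Mapping.single k (sum_list \<delta>)" and ?b = "Poly_Mapping.single k (sum_list \<epsilon>)"
  have "shuffle_sum (level_series k) \<delta> \<epsilon> =
      (\<Sum>\<sigma>\<in>#shuffle_mset \<delta> \<epsilon>. monom_series (1 / fact (length \<delta> + length \<epsilon>)) (?a + ?b))"
    unfolding shuffle_sum_def level_series_def
    by (intro arg_cong[of _ _ sum_mset] image_mset_cong)
       (simp add: length_in_shuffle_mset sum_list_in_shuffle_mset single_add)
  then have "mps_coeff (shuffle_sum (level_series k) \<delta> \<epsilon>) m =
      (\<Sum>\<sigma>\<in>#shuffle_mset \<delta> \<epsilon>. if m = ?a + ?b then 1 / fact (length \<delta> + length \<epsilon>) else 0)"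
    by (simp only: mps_coeff_sum_mset mps_coeff_simps)
  also have "\<dots> = of_nat ((length \<delta> + length \<epsilon>) choose length \<delta>) *
        (if m = ?a + ?b then 1 / fact (length \<delta> + length \<epsilon>) else 0)"
    by (simp add: size_shuffle_mset)
  also have "\<dots> = mps_coeff (level_series k \<delta> * level_series k \<epsilon>) m"
    by (auto simp: level_series_def mps_coeff_monom_series_times binomial_fact)
  finally show "mps_coeff (level_series k \<delta> * level_series k \<epsilon>) m =
      mps_coeff (shuffle_sum (level_series k) \<delta> \<epsilon>) m" ..
qed

text \<open>\<open>exp_poly ks \<delta>\<close> is \<open>E\<^sub>\<delta>\<close> restricted to the variables with index in \<open>ks\<close>.\<close>

fun exp_poly :: "nat list \<Rightarrow> nat list \<Rightarrow> rat mps" where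
  "exp_poly [] = (\<lambda>\<delta>. if \<delta> = [] then 1 else 0)"
| "exp_poly (k # ks) = convolve (level_series k) (exp_poly ks)"

lemma exp_poly_shuffle: "exp_poly ks \<delta> * exp_poly ks \<epsilon> = shuffle_sum (exp_poly ks) \<delta> \<epsilon>"
proof (induction ks arbitrary: \<delta> \<epsilon>)
  case Nil
  \<comment> \<open>Without variables only emptiness of a word matters, and that is the same for
    every shuffle as for \<open>\<delta> @ \<epsilon>\<close>.\<close>
  have "shuffle_sum (exp_poly []) \<delta> \<epsilon> = (\<Sum>\<sigma>\<in>#shuffle_mset \<delta> \<epsilon>. exp_poly [] (\<delta> @ \<epsilon>))"
    unfolding shuffle_sum_def
    by (intro arg_cong[of _ _ sum_mset] image_mset_cong)
       (auto dest: length_in_shuffle_mset)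
  also have "\<dots> = exp_poly [] \<delta> * exp_poly [] \<epsilon>"
    by auto
  finally show ?case ..
next
  case (Cons k ks)
  show ?case
    unfolding exp_poly.simps using level_series_shuffle Cons.IH by (rule convolve_shuffle)
qed

text \<open>This is the coefficient of the monomial function of \<open>\<alpha>\<close> in the
  exponential of \<open>\<delta>\<close>: cut \<open>\<delta>\<close> into consecutive blocks with
  sums \<open>\<alpha>\<close> and weight each block of length \<open>i\<close> by
  \<open>1 / fact i\<close>.\<close>

fun exp_coeff :: "nat list \<Rightarrow> nat list \<Rightarrow> rat" where
  "exp_coeff \<delta> [] = (if \<delta> = [] then 1 else 0)"
| "exp_coeff \<delta> (a # \<alpha>) = (\<Sum>i\<le>length \<delta>.
     if sum_list (take i \<delta>) = a then exp_coeff (drop i \<delta>) \<alpha> / fact i else 0)"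

lemma keys_exp_poly: "mps_coeff (exp_poly ks \<delta>) m \<noteq> 0 \<Longrightarrow> Poly_Mapping.keys m \<subseteq> set ks"
proof (induction ks arbitrary: \<delta> m)
  case Nil
  then show ?case by (auto split: if_splits)
next
  case (Cons k ks)
  from Cons.prems
  have "(\<Sum>i\<le>length \<delta>. mps_coeff (level_series k (take i \<delta>) * exp_poly ks (drop i \<delta>)) m) \<noteq> 0"
    by (simp add: convolve_def mps_coeff_sum)
  then obtain i where "mps_coeff (level_series k (take i \<delta>) * exp_poly ks (drop i \<delta>)) m \<noteq> 0"
    by (rule sum.not_neutral_contains_not_neutral)
  then obtain b where b: "Poly_Mapping.single k (sum_list (take i \<delta>)) + b = m"
    "mps_coeff (exp_poly ks (drop i \<delta>)) b \<noteq> 0"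
    unfolding level_series_def mps_coeff_monom_series_times
    by (metis add_diff_cancel_left' mult_zero_right)
  have "Poly_Mapping.keys m \<subseteq> Poly_Mapping.keys (Poly_Mapping.single k (sum_list (take i \<delta>))) \<union> Poly_Mapping.keys b"
    unfolding b(1)[symmetric] by (rule Poly_Mapping.keys_add)
  also have "\<dots> \<subseteq> set (k # ks)"
    using Cons.IH[OF b(2)] by (auto split: if_splits)
  finally show ?case .
qed

text \<open>Each variable takes the next block of \<open>\<delta>\<close>. A variable absent from
  \<open>m\<close> takes an empty block, since the parts are positive, so only the nonzero exponents
  matter.\<close>

lemma mps_coeff_exp_poly:
  assumes "is_composition \<delta>" "distinct ks" "Poly_Mapping.keys m \<subseteq> set ks"
  shows "mps_coeff (exp_poly ks \<delta>) m =
    exp_coeff \<delta> (map (Poly_Mapping.lookup m) (filter (\<lambda>k. k \<in> Poly_Mapping.keys m) ks))"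
  using assms
proof (induction ks arbitrary: \<delta> m)
  case Nil
  then show ?case by auto
next
  case (Cons k ks)
  \<comment> \<open>The monomial \<open>m\<close> with the variable of index \<open>k\<close>
    removed.\<close>
  define m' where "m' = m - Poly_Mapping.single k (Poly_Mapping.lookup m k)"
  let ?e = "\<lambda>\<delta>. exp_coeff \<delta> (map (Poly_Mapping.lookup m) (filter (\<lambda>k. k \<in> Poly_Mapping.keys m) ks))"
  have lookup_m': "Poly_Mapping.lookup m' l = (if l = k then 0 else Poly_Mapping.lookup m l)" for l
    by (simp add: m'_def lookup_minus lookup_single when_def)
  have m: "Poly_Mapping.single k (Poly_Mapping.lookup m k) + m' = m"
    by (rule poly_mapping_eqI) (simp add: lookup_add lookup_m' lookup_single when_def)
  have drop: "is_composition (drop i \<delta>)" for i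
    using Cons.prems(1) by (auto simp: is_composition_def dest: in_set_dropD)
  have "Poly_Mapping.keys m' = Poly_Mapping.keys m - {k}"
    by (auto simp: in_keys_iff lookup_m' split: if_splits)
  then have "filter (\<lambda>k. k \<in> Poly_Mapping.keys m') ks = filter (\<lambda>k. k \<in> Poly_Mapping.keys m) ks"
    using Cons.prems(2) by (auto intro!: filter_cong)
  then have "map (Poly_Mapping.lookup m') (filter (\<lambda>k. k \<in> Poly_Mapping.keys m') ks) =
      map (Poly_Mapping.lookup m) (filter (\<lambda>k. k \<in> Poly_Mapping.keys m) ks)"
    using Cons.prems(2) by (auto simp: lookup_m')
  then have e: "mps_coeff (exp_poly ks (drop i \<delta>)) m' = ?e (drop i \<delta>)" for i
    using Cons.IH[OF drop, of m' i] Cons.prems \<open>Poly_Mapping.keys m' = Poly_Mapping.keys m - {k}\<close>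
    by auto
  have split: "mps_coeff (level_series k (take i \<delta>) * exp_poly ks (drop i \<delta>)) m =
      (if sum_list (take i \<delta>) = Poly_Mapping.lookup m k then ?e (drop i \<delta>) / fact i else 0)"
    if "i \<le> length \<delta>" for i
  proof (cases "sum_list (take i \<delta>) = Poly_Mapping.lookup m k")
    case True
    then show ?thesis
      using that m by (auto simp: level_series_def mps_coeff_monom_series_times e m'_def[symmetric])
  next
    case False
    \<comment> \<open>The remaining factor involves only variables from \<open>ks\<close>, which
      omits \<open>k\<close>, so it cannot correct a wrong exponent at \<open>k\<close>.\<close>
    have "mps_coeff (exp_poly ks (drop i \<delta>)) b = 0"
      if "Poly_Mapping.single k (sum_list (take i \<delta>)) + b = m" for b
    proof (rule ccontr)
      assume "mps_coeff (exp_poly ks (drop i \<delta>)) b \<noteq> 0"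
      then have "Poly_Mapping.lookup b k = 0"
        using keys_exp_poly[of ks] Cons.prems(2) by (force simp: in_keys_iff)
      then show False
        using False that by (auto simp: lookup_add)
    qed
    then show ?thesis
      using False by (auto simp: level_series_def mps_coeff_monom_series_times)
  qed
  have *: "mps_coeff (exp_poly (k # ks) \<delta>) m = (\<Sum>i\<le>length \<delta>.
      if sum_list (take i \<delta>) = Poly_Mapping.lookup m k then ?e (drop i \<delta>) / fact i else 0)"
    by (simp add: convolve_def mps_coeff_sum split)
  show ?case
  proof (cases "k \<in> Poly_Mapping.keys m")
    case True
    then show ?thesis using * by simp
  next
    case False
    have zero: "sum_list (take i \<delta>) = 0 \<longleftrightarrow> i = 0" if "i \<le> length \<delta>" for i
      using that Cons.prems(1) by (cases \<delta>; cases i) (auto simp: is_composition_def)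
    have "mps_coeff (exp_poly (k # ks) \<delta>) m = (\<Sum>i\<le>length \<delta>. if i = 0 then ?e \<delta> else 0)"
      unfolding * using False by (intro sum.cong) (auto simp: in_keys_iff zero simp del: sum_list_eq_0_iff)
    then show ?thesis using False by simp
  qed
qed

section \<open>From finitely many variables to power series\<close>

definition exponents :: "monomial \<Rightarrow> nat list" where
  "exponents m = map (Poly_Mapping.lookup m) (sorted_list_of_set (Poly_Mapping.keys m))"

lift_definition exp_series :: "nat list \<Rightarrow> rat mps" is "\<lambda>\<delta> m. exp_coeff \<delta> (exponents m)" .

lemma mps_coeff_exp_series:
  assumes "is_composition \<delta>" "Poly_Mapping.keys m \<subseteq> {..<N}"
  shows "mps_coeff (exp_series \<delta>) m = mps_coeff (exp_poly [0..<N] \<delta>) m"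
proof -
  have "filter (\<lambda>k. k \<in> Poly_Mapping.keys m) [0..<N] = sorted_list_of_set (Poly_Mapping.keys m)"
  proof -
    have "set (filter (\<lambda>k. k \<in> Poly_Mapping.keys m) [0..<N]) = Poly_Mapping.keys m"
      using assms(2) by auto
    then show ?thesis
      using sorted_list_of_set.idem_if_sorted_distinct[of "filter (\<lambda>k. k \<in> Poly_Mapping.keys m) [0..<N]"]
      by (simp add: sorted_wrt_filter)
  qed
  then show ?thesis
    using assms by (simp add: exp_series.rep_eq mps_coeff_exp_poly exponents_def lessThan_atLeast0)
qed

text \<open>A coefficient of a product at \<open>m\<close> only involves divisors of
  \<open>m\<close>, so finitely many variables suffice and \<open>exp_poly_shuffle\<close>
  applies.\<close>

lemma exp_series_mult:
  assumes "is_composition \<delta>" "is_composition \<epsilon>"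
  shows "exp_series \<delta> * exp_series \<epsilon> = (\<Sum>\<sigma>\<in>#shuffle_mset \<delta> \<epsilon>. exp_series \<sigma>)"
proof (rule mps_eqI)
  fix m :: monomial
  obtain N where N: "Poly_Mapping.keys m \<subseteq> {..<N}"
    using finite_nat_set_iff_bounded[of "Poly_Mapping.keys m"] by auto
  have sub: "Poly_Mapping.keys a \<subseteq> {..<N}" "Poly_Mapping.keys b \<subseteq> {..<N}"
    if "(a, b) \<in> mdecomp m" for a b
  proof -
    have "Poly_Mapping.keys a \<union> Poly_Mapping.keys b \<subseteq> Poly_Mapping.keys m"
      using that by (auto simp: mdecomp_def in_keys_iff lookup_add)
    with N show "Poly_Mapping.keys a \<subseteq> {..<N}" "Poly_Mapping.keys b \<subseteq> {..<N}" by auto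
  qed
  have "mps_coeff (exp_series \<delta> * exp_series \<epsilon>) m =
      mps_coeff (exp_poly [0..<N] \<delta> * exp_poly [0..<N] \<epsilon>) m"
    unfolding mps_coeff_times
  proof (rule sum.cong[OF refl], clarify)
    fix a b assume "(a, b) \<in> mdecomp m"
    then show "mps_coeff (exp_series \<delta>) a * mps_coeff (exp_series \<epsilon>) b =
        mps_coeff (exp_poly [0..<N] \<delta>) a * mps_coeff (exp_poly [0..<N] \<epsilon>) b"
      using sub assms by (intro arg_cong2[of _ _ _ _ "(*)"] mps_coeff_exp_series)
  qed
  also have "\<dots> = (\<Sum>\<sigma>\<in>#shuffle_mset \<delta> \<epsilon>. mps_coeff (exp_poly [0..<N] \<sigma>) m)"
    by (simp add: exp_poly_shuffle shuffle_sum_def mps_coeff_sum_mset)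
  also have "\<dots> = (\<Sum>\<sigma>\<in>#shuffle_mset \<delta> \<epsilon>. mps_coeff (exp_series \<sigma>) m)"
    using assms
    by (intro arg_cong[of _ _ sum_mset] image_mset_cong mps_coeff_exp_series[OF _ N, symmetric])
       (auto simp: is_composition_def set_in_shuffle_mset)
  finally show "mps_coeff (exp_series \<delta> * exp_series \<epsilon>) m =
      mps_coeff (\<Sum>\<sigma>\<in>#shuffle_mset \<delta> \<epsilon>. exp_series \<sigma>) m"
    by (simp add: mps_coeff_sum_mset)
qed

text \<open>A dimension count: in degrees up to \<open>n\<close>, \<open>T\<close> spans the same
  space as the independent family \<open>B\<close> with the same finite index set, so it can have
  neither repetitions nor relations.\<close>

lemma (in vector_space) graded_basis_change:
  fixes B T :: "'i \<Rightarrow> 'b" and C :: "nat \<Rightarrow> 'i set"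
  assumes inj: "inj_on B (\<Union>n. C n)" and ind: "independent (B ` (\<Union>n. C n))"
    and fin: "\<And>n. finite (C n)"
    and B: "\<And>i n. i \<in> C n \<Longrightarrow> B i \<in> span (T ` C n)"
    and T: "\<And>i n. i \<in> C n \<Longrightarrow> T i \<in> span (B ` C n)"
  shows "inj_on T (\<Union>n. C n)"
    and "independent (T ` (\<Union>n. C n))"
    and "span (T ` (\<Union>n. C n)) = span (B ` (\<Union>n. C n))"
proof -
  have span_eqI: "span (T ` (\<Union>n\<in>N. C n)) = span (B ` (\<Union>n\<in>N. C n))" for N
  proof -
    have le: "f ` (\<Union>n\<in>N. C n) \<subseteq> span (g ` (\<Union>n\<in>N. C n))"
      if "\<And>i n. i \<in> C n \<Longrightarrow> f i \<in> span (g ` C n)" for f g :: "'i \<Rightarrow> 'b"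
    proof (rule image_subsetI)
      fix i assume "i \<in> (\<Union>n\<in>N. C n)"
      then obtain n where n: "n \<in> N" "i \<in> C n" by (elim UN_E)
      have "g ` C n \<subseteq> g ` (\<Union>n\<in>N. C n)" using n(1) by (intro image_mono UN_upper)
      from span_mono[OF this] that[OF n(2)] show "f i \<in> span (g ` (\<Union>n\<in>N. C n))"
        by (rule subsetD)
    qed
    show ?thesis using le[OF T] le[OF B] by (simp only: span_eq)
  qed
  then show "span (T ` (\<Union>n. C n)) = span (B ` (\<Union>n. C n))" .
  define C' where "C' n = (\<Union>k\<le>n. C k)" for n
  have C': "finite (C' n)" "C' n \<subseteq> (\<Union>n. C n)" for n using fin by (auto simp: C'_def)
  have C'_mono: "C' m \<subseteq> C' n" if "m \<le> n" for m n using that by (force simp: C'_def)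
  have dim: "dim (T ` C' n) = card (C' n)" for n
  proof -
    have "dim (T ` C' n) = dim (B ` C' n)"
      unfolding C'_def by (rule span_eq_dim[OF span_eqI])
    also have "\<dots> = card (B ` C' n)"
      using independent_mono[OF ind] C'(2) by (intro dim_eq_card_independent) (metis image_mono)
    also have "\<dots> = card (C' n)"
      using inj_on_subset[OF inj C'(2)] by (rule card_image)
    finally show ?thesis .
  qed
  \<comment> \<open>The cardinality of the image lies between the dimension and
    \<open>card (C' n)\<close>, which agree.\<close>
  have cardT: "card (T ` C' n) = card (C' n)" for n
    using dim[of n] dim_le_card'[of "T ` C' n"] card_image_le[OF C'(1), of T n] C'(1)[of n] by simp
  have injT: "inj_on T (C' n)" for n
    using C'(1) cardT by (rule eq_card_imp_inj_on)
  have indT: "independent (T ` C' n)" for n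
  proof -
    obtain S where S: "S \<subseteq> T ` C' n" "independent S" "card S = dim (T ` C' n)"
      using basis_exists by blast
    have "S = T ` C' n"
      using S dim[of n] cardT[of n] C'(1)[of n] by (intro card_subset_eq) auto
    with S show ?thesis by simp
  qed
  show "inj_on T (\<Union>n. C n)"
  proof (rule inj_onI)
    fix i j assume "i \<in> (\<Union>n. C n)" "j \<in> (\<Union>n. C n)" and eq: "T i = T j"
    then obtain m n where "i \<in> C' m" "j \<in> C' n" by (auto simp: C'_def)
    then have "i \<in> C' (max m n)" "j \<in> C' (max m n)"
      using C'_mono[of m "max m n"] C'_mono[of n "max m n"] by auto
    with inj_onD[OF injT eq] show "i = j" by blast
  qed
  \<comment> \<open>A linear relation involves finitely many vectors, so it already lives in a
    single \<open>C' n\<close>.\<close>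
  have directed: "\<exists>n. S \<subseteq> C' n" if "finite S" "S \<subseteq> (\<Union>n. C n)" for S
    using that
  proof (induction S rule: finite_induct)
    case (insert i S)
    then obtain m n where "S \<subseteq> C' m" "i \<in> C' n" by (auto simp: C'_def)
    then have "insert i S \<subseteq> C' (max m n)"
      using C'_mono[of m "max m n"] C'_mono[of n "max m n"] by auto
    then show ?case ..
  qed simp
  show "independent (T ` (\<Union>n. C n))"
  proof
    assume "dependent (T ` (\<Union>n. C n))"
    then obtain S u v where S: "finite S" "S \<subseteq> T ` (\<Union>n. C n)"
        "(\<Sum>v\<in>S. u v *s v) = 0" "v \<in> S" "u v \<noteq> 0"
      unfolding dependent_explicit by blast
    from finite_subset_image[OF S(1,2)] obtain R where R: "R \<subseteq> (\<Union>n. C n)" "finite R" "S = T ` R"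
      by blast
    with directed obtain n where "R \<subseteq> C' n" by blast
    then have "S \<subseteq> T ` C' n" using R(3) by blast
    with S have "dependent (T ` C' n)" unfolding dependent_explicit by blast
    with indT show False by blast
  qed
qed

lemma (in vector_space) span_sum_mset: "(\<And>i. i \<in># I \<Longrightarrow> f i \<in> span S) \<Longrightarrow> (\<Sum>i\<in>#I. f i) \<in> span S"
  by (induction I) (auto intro: span_add span_zero)

section \<open>The monomial basis of \<open>QSym\<close>\<close>

lemma exponents_composition: "is_composition (exponents m)"
  by (auto simp: is_composition_def exponents_def in_keys_iff)

lemma sum_list_exponents: "sum_list (exponents m) = mdegree m"
  by (simp add: exponents_def mdegree_def sum_list_distinct_conv_sum_set)

lemma
  assumes "distinct is" "is_composition \<alpha>" "length is = length \<alpha>"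
  shows keys_mono_of: "Poly_Mapping.keys (mono_of is \<alpha>) = set is"
    and lookup_mono_of: "map (Poly_Mapping.lookup (mono_of is \<alpha>)) is = \<alpha>"
proof -
  have "Poly_Mapping.keys (mono_of is \<alpha>) = set is \<and> map (Poly_Mapping.lookup (mono_of is \<alpha>)) is = \<alpha>"
    using assms
  proof (induction "is" arbitrary: \<alpha>)
    case Nil
    then show ?case by (simp add: mono_of_def)
  next
    case (Cons i "is")
    from Cons.prems obtain a \<alpha>' where \<alpha>: "\<alpha> = a # \<alpha>'" by (cases \<alpha>) auto
    have eq: "mono_of (i # is) (a # \<alpha>') = Poly_Mapping.single i a + mono_of is \<alpha>'"
      by (simp add: mono_of_def)
    have IH: "Poly_Mapping.keys (mono_of is \<alpha>') = set is" "map (Poly_Mapping.lookup (mono_of is \<alpha>')) is = \<alpha>'"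
      using Cons.IH[of \<alpha>'] Cons.prems by (auto simp: \<alpha> is_composition_def)
    have a: "0 < a" and i: "i \<notin> set is" using Cons.prems by (auto simp: \<alpha> is_composition_def)
    have 0: "Poly_Mapping.lookup (mono_of is \<alpha>') i = 0"
      using IH(1) i by (metis in_keys_iff)
    have lk: "Poly_Mapping.lookup (mono_of (i # is) (a # \<alpha>')) k =
        (if k = i then a else Poly_Mapping.lookup (mono_of is \<alpha>') k)" for k
      unfolding eq using 0 by (auto simp: lookup_add lookup_single when_def)
    have "Poly_Mapping.keys (mono_of (i # is) (a # \<alpha>')) = insert i (Poly_Mapping.keys (mono_of is \<alpha>'))"
      using a by (auto simp: in_keys_iff lk split: if_splits)
    moreover have "map (Poly_Mapping.lookup (mono_of (i # is) (a # \<alpha>'))) is = \<alpha>'"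
    proof -
      have "map (Poly_Mapping.lookup (mono_of (i # is) (a # \<alpha>'))) is = map (Poly_Mapping.lookup (mono_of is \<alpha>')) is"
        using i by (intro map_cong) (auto simp: lk)
      with IH(2) show ?thesis by simp
    qed
    ultimately show ?case using IH(1) lk[of i] by (simp add: \<alpha>)
  qed
  then show "Poly_Mapping.keys (mono_of is \<alpha>) = set is"
    "map (Poly_Mapping.lookup (mono_of is \<alpha>)) is = \<alpha>" by auto
qed

lemma exponents_mono_of:
  assumes "sorted_wrt (<) is" "is_composition \<alpha>" "length is = length \<alpha>"
  shows "exponents (mono_of is \<alpha>) = \<alpha>"
proof -
  have "sorted is" "distinct is" using assms(1) by (simp_all add: strict_sorted_iff)
  then show ?thesis
    using assms keys_mono_of[of "is" \<alpha>] lookup_mono_of[of "is" \<alpha>]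
    by (simp add: exponents_def sorted_list_of_set.idem_if_sorted_distinct)
qed

text \<open>This makes the invariance condition of \<open>QSym\<close>, stated for
  \<open>mono_of\<close>, available for every monomial.\<close>

lemma mono_of_exponents: "mono_of (sorted_list_of_set (Poly_Mapping.keys m)) (exponents m) = m"
proof (rule poly_mapping_eqI)
  fix k
  let ?is = "sorted_list_of_set (Poly_Mapping.keys m)"
  have len: "length ?is = length (exponents m)" by (simp add: exponents_def)
  have "map (Poly_Mapping.lookup (mono_of ?is (exponents m))) ?is = map (Poly_Mapping.lookup m) ?is"
    using lookup_mono_of[OF _ exponents_composition len] by (simp add: exponents_def)
  moreover have "Poly_Mapping.keys (mono_of ?is (exponents m)) = Poly_Mapping.keys m"
    using keys_mono_of[OF _ exponents_composition len] by simp
  ultimately show "Poly_Mapping.lookup (mono_of ?is (exponents m)) k = Poly_Mapping.lookup m k"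
    by (cases "k \<in> Poly_Mapping.keys m") (auto simp: in_keys_iff map_eq_conv)
qed

definition monomial_qsym :: "nat list \<Rightarrow> rat mps" where
  "monomial_qsym \<alpha> = Abs_mps (\<lambda>m. if exponents m = \<alpha> then 1 else 0)"

lemma mps_coeff_monomial_qsym: "mps_coeff (monomial_qsym \<alpha>) m = (if exponents m = \<alpha> then 1 else 0)"
  by (simp add: monomial_qsym_def Abs_mps_inverse)

text \<open>One monomial with exponents \<open>\<alpha>\<close>; its coefficient serves as the
  coordinate at \<open>monomial_qsym \<alpha>\<close>.\<close>

abbreviation std_mono :: "nat list \<Rightarrow> monomial" where
  "std_mono \<alpha> \<equiv> mono_of [0..<length \<alpha>] \<alpha>"

lemma exponents_std_mono: "is_composition \<alpha> \<Longrightarrow> exponents (std_mono \<alpha>) = \<alpha>"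
  by (rule exponents_mono_of) auto

lemma inj_monomial_qsym: "inj_on monomial_qsym (Collect is_composition)"
proof (rule inj_onI)
  fix \<alpha> \<beta> assume "\<alpha> \<in> Collect is_composition" "monomial_qsym \<alpha> = monomial_qsym \<beta>"
  then have "mps_coeff (monomial_qsym \<beta>) (std_mono \<alpha>) = 1"
    by (metis exponents_std_mono mem_Collect_eq mps_coeff_monomial_qsym)
  with \<open>\<alpha> \<in> _\<close> show "\<alpha> = \<beta>"
    by (simp add: mps_coeff_monomial_qsym exponents_std_mono split: if_splits)
qed

lemma independent_monomial_qsym: "mps.independent (monomial_qsym ` Collect is_composition)"
proof
  assume "mps.dependent (monomial_qsym ` Collect is_composition)"
  then obtain S u v where S: "finite S" "S \<subseteq> monomial_qsym ` Collect is_composition"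
    "(\<Sum>v\<in>S. mps_scale (u v) v) = 0" "v \<in> S" "u v \<noteq> 0"
    unfolding mps.dependent_explicit by blast
  from S obtain \<alpha> where \<alpha>: "is_composition \<alpha>" "v = monomial_qsym \<alpha>" by auto
  have "mps_coeff w (std_mono \<alpha>) = (if w = v then 1 else 0)" if "w \<in> S" for w
    using that S(2) \<alpha> by (auto simp: mps_coeff_monomial_qsym exponents_std_mono)
  then have "mps_coeff (\<Sum>v\<in>S. mps_scale (u v) v) (std_mono \<alpha>) = (\<Sum>w\<in>S. if w = v then u w else 0)"
    unfolding mps_coeff_sum by (intro sum.cong) auto
  with S show False by simp
qed

lemma subspace_QSym: "mps.subspace QSym"
proof (rule mps.subspaceI)
  show "0 \<in> QSym" by (simp add: QSym_def)
next
  fix f g assume fg: "f \<in> QSym" "g \<in> QSym"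
  then obtain d e where de: "\<forall>m. mps_coeff f m \<noteq> 0 \<longrightarrow> mdegree m \<le> d" "\<forall>m. mps_coeff g m \<noteq> 0 \<longrightarrow> mdegree m \<le> e"
    by (auto simp: QSym_def)
  then have "\<forall>m. mps_coeff (f + g) m \<noteq> 0 \<longrightarrow> mdegree m \<le> max d e"
    by (metis add_0 le_max_iff_disj mps_coeff_simps(3))
  then have "\<exists>d. \<forall>m. mps_coeff (f + g) m \<noteq> 0 \<longrightarrow> mdegree m \<le> d" ..
  with fg show "f + g \<in> QSym" unfolding QSym_def mem_Collect_eq mps_coeff_simps by metis
next
  fix c f assume "f \<in> QSym"
  then show "mps_scale c f \<in> QSym" unfolding QSym_def mem_Collect_eq mps_coeff_simps by (metis mult_zero_right)
qed

lemma span_monomial_qsym: "mps.span (monomial_qsym ` Collect is_composition) = QSym"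
proof
  show "mps.span (monomial_qsym ` Collect is_composition) \<subseteq> QSym"
  proof (rule mps.span_minimal[OF _ subspace_QSym], clarify)
    fix \<alpha>
    show "monomial_qsym \<alpha> \<in> QSym"
      by (auto simp: QSym_def mps_coeff_monomial_qsym exponents_mono_of simp flip: sum_list_exponents)
  qed
  show "QSym \<subseteq> mps.span (monomial_qsym ` Collect is_composition)"
  proof
    fix f assume f: "f \<in> QSym"
    then obtain d where d: "\<And>m. mps_coeff f m \<noteq> 0 \<Longrightarrow> mdegree m \<le> d" by (auto simp: QSym_def)
    \<comment> \<open>The degree bound leaves finitely many compositions, so the expansion of
      \<open>f\<close> is a finite sum.\<close>
    define A where "A = (\<Union>n\<le>d. compositions n)"
    have finA: "finite A" by (simp add: A_def finite_compositions)
    have "f = (\<Sum>\<alpha>\<in>A. mps_scale (mps_coeff f (std_mono \<alpha>)) (monomial_qsym \<alpha>))"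
    proof (rule mps_eqI)
      fix m
      have "mps_coeff f (mono_of (sorted_list_of_set (Poly_Mapping.keys m)) (exponents m)) =
          mps_coeff f (std_mono (exponents m))"
      proof -
        have "sorted_wrt (<) [0..<length (exponents m)]" by simp
        moreover have "length (sorted_list_of_set (Poly_Mapping.keys m)) = length (exponents m)"
          by (simp add: exponents_def)
        ultimately show ?thesis
          using f exponents_composition[of m] by (auto simp: QSym_def)
      qed
      then have "mps_coeff f m = mps_coeff f (std_mono (exponents m))"
        by (simp only: mono_of_exponents)
      moreover have "exponents m \<in> A" if "mps_coeff f m \<noteq> 0"
        using d[OF that] by (auto simp: A_def compositions_def exponents_composition sum_list_exponents)
      ultimately have "mps_coeff f m = (\<Sum>\<alpha>\<in>A. if exponents m = \<alpha> then mps_coeff f (std_mono \<alpha>) else 0)"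
        using finA by auto
      also have "\<dots> = mps_coeff (\<Sum>\<alpha>\<in>A. mps_scale (mps_coeff f (std_mono \<alpha>)) (monomial_qsym \<alpha>)) m"
        unfolding mps_coeff_sum by (intro sum.cong) (auto simp: mps_coeff_monomial_qsym)
      finally show "mps_coeff f m =
          mps_coeff (\<Sum>\<alpha>\<in>A. mps_scale (mps_coeff f (std_mono \<alpha>)) (monomial_qsym \<alpha>)) m" .
    qed
    also have "\<dots> \<in> mps.span (monomial_qsym ` Collect is_composition)"
      by (intro mps.span_sum mps.span_scale mps.span_base) (auto simp: A_def compositions_def)
    finally show "f \<in> mps.span (monomial_qsym ` Collect is_composition)" .
  qed
qed

text \<open>A nonzero coefficient means that \<open>\<alpha>\<close> arises from
  \<open>\<delta>\<close> by adding up consecutive blocks, which shortens it unless all blocks are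
  single parts.\<close>

lemma exp_coeff_neq_0:
  assumes "exp_coeff \<delta> \<alpha> \<noteq> 0" "is_composition \<alpha>"
  shows "sum_list \<alpha> = sum_list \<delta> \<and> (length \<alpha> < length \<delta> \<or> \<alpha> = \<delta>)"
  using assms
proof (induction \<alpha> arbitrary: \<delta>)
  case Nil
  then show ?case by (auto split: if_splits)
next
  case (Cons a \<alpha>)
  from Cons.prems(1) obtain i where i: "i \<le> length \<delta>" "sum_list (take i \<delta>) = a" "exp_coeff (drop i \<delta>) \<alpha> \<noteq> 0"
    unfolding exp_coeff.simps
    by (elim sum.not_neutral_contains_not_neutral) (auto split: if_splits)
  have IH: "sum_list \<alpha> = sum_list (drop i \<delta>)" "length \<alpha> < length (drop i \<delta>) \<or> \<alpha> = drop i \<delta>"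
    using Cons.IH[OF i(3)] Cons.prems(2) by (auto simp: is_composition_def)
  have "0 < i" using i(2) Cons.prems(2) by (cases i) (auto simp: is_composition_def)
  have "sum_list (a # \<alpha>) = sum_list \<delta>"
    using IH(1) i(2) by (metis append_take_drop_id sum_list.Cons sum_list_append)
  moreover have "length (a # \<alpha>) < length \<delta> \<or> a # \<alpha> = \<delta>"
  proof (cases "i = 1")
    case True
    then obtain b \<delta>' where "\<delta> = b # \<delta>'" using i(1) by (cases \<delta>) auto
    then show ?thesis using IH(2) i(2) True by auto
  next
    case False
    then show ?thesis using IH(2) i(1) \<open>0 < i\<close> by auto
  qed
  ultimately show ?case by blast
qed

lemma exp_coeff_self: "is_composition \<delta> \<Longrightarrow> exp_coeff \<delta> \<delta> = 1"
proof (induction \<delta>)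
  case Nil
  then show ?case by simp
next
  case (Cons a \<delta>)
  have *: "sum_list (take i (a # \<delta>)) = a \<longleftrightarrow> i = 1" if "i \<le> Suc (length \<delta>)" for i
  proof (cases i)
    case 0
    then show ?thesis using Cons.prems by (auto simp: is_composition_def)
  next
    case (Suc k)
    then show ?thesis using Cons.prems that by (cases k; cases \<delta>) (auto simp: is_composition_def)
  qed
  have "exp_coeff (a # \<delta>) (a # \<delta>) = (\<Sum>i\<le>Suc (length \<delta>). if i = 1 then exp_coeff \<delta> \<delta> else 0)"
    unfolding exp_coeff.simps length_Cons
    by (intro sum.cong) (auto simp only: * atMost_iff drop_Suc_Cons take_Suc_Cons drop_0 One_nat_def fact_1 fact_Suc fact_0 split: if_split)
  also have "\<dots> = exp_coeff \<delta> \<delta>"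
    by (subst sum.delta) auto
  finally show ?case using Cons by (simp add: is_composition_def)
qed

lemma exp_series_expansion:
  "exp_series \<delta> = (\<Sum>\<alpha>\<in>compositions (sum_list \<delta>). mps_scale (exp_coeff \<delta> \<alpha>) (monomial_qsym \<alpha>))"
proof (rule mps_eqI)
  fix m
  have "mps_coeff (\<Sum>\<alpha>\<in>compositions (sum_list \<delta>). mps_scale (exp_coeff \<delta> \<alpha>) (monomial_qsym \<alpha>)) m =
      (\<Sum>\<alpha>\<in>compositions (sum_list \<delta>). if exponents m = \<alpha> then exp_coeff \<delta> \<alpha> else 0)"
    unfolding mps_coeff_sum by (intro sum.cong) (auto simp: mps_coeff_monomial_qsym)
  also have "\<dots> = exp_coeff \<delta> (exponents m)"
  proof -
    have "exponents m \<in> compositions (sum_list \<delta>)" if "exp_coeff \<delta> (exponents m) \<noteq> 0"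
      using exp_coeff_neq_0[OF that] exponents_composition by (simp add: compositions_def)
    then show ?thesis by (auto simp: finite_compositions)
  qed
  finally show "mps_coeff (exp_series \<delta>) m =
      mps_coeff (\<Sum>\<alpha>\<in>compositions (sum_list \<delta>). mps_scale (exp_coeff \<delta> \<alpha>) (monomial_qsym \<alpha>)) m"
    by (simp add: exp_series.rep_eq)
qed

lemma Collect_is_composition: "Collect is_composition = (\<Union>n. compositions n)"
  by (auto simp: compositions_def)

text \<open>Inversion of a unitriangular expansion: all other terms of
  \<open>exp_series \<delta>\<close> belong to shorter compositions, covered by induction.\<close>

lemma monomial_qsym_in_span:
  assumes "\<delta> \<in> compositions n"
  shows "monomial_qsym \<delta> \<in> mps.span (exp_series ` compositions n)"
  using assms
proof (induction "length \<delta>" arbitrary: \<delta> rule: less_induct)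
  case less
  then have \<delta>: "is_composition \<delta>" "sum_list \<delta> = n" by (auto simp: compositions_def)
  let ?R = "\<Sum>\<alpha>\<in>compositions n - {\<delta>}. mps_scale (exp_coeff \<delta> \<alpha>) (monomial_qsym \<alpha>)"
  have "exp_series \<delta> = monomial_qsym \<delta> + ?R"
    using less.prems exp_coeff_self[OF \<delta>(1)]
    by (simp add: exp_series_expansion \<delta>(2) sum.remove[OF finite_compositions])
  then have eq: "monomial_qsym \<delta> = exp_series \<delta> - ?R" by (simp add: algebra_simps)
  have "?R \<in> mps.span (exp_series ` compositions n)"
  proof (rule mps.span_sum)
    fix \<alpha> assume \<alpha>: "\<alpha> \<in> compositions n - {\<delta>}"
    show "mps_scale (exp_coeff \<delta> \<alpha>) (monomial_qsym \<alpha>) \<in> mps.span (exp_series ` compositions n)"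
    proof (cases "exp_coeff \<delta> \<alpha> = 0")
      case True
      then show ?thesis by (simp add: mps.span_zero)
    next
      case False
      then have "length \<alpha> < length \<delta>"
        using exp_coeff_neq_0[OF False] \<alpha> by (auto simp: compositions_def)
      then show ?thesis using less.hyps[of \<alpha>] \<alpha> by (auto intro: mps.span_scale)
    qed
  qed
  then show ?case
    unfolding eq using less.prems by (intro mps.span_diff mps.span_base[of "exp_series \<delta>"]) auto
qed

lemma exp_series_in_span_monomial_qsym:
  assumes "\<delta> \<in> compositions n"
  shows "exp_series \<delta> \<in> mps.span (monomial_qsym ` compositions n)"
proof -
  have "sum_list \<delta> = n" using assms by (simp add: compositions_def)
  then show ?thesis
    unfolding exp_series_expansion by (intro mps.span_sum mps.span_scale mps.span_base) auto
qed

lemma exp_series_basis: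
  shows "inj_on exp_series (Collect is_composition)"
    and "mps.independent (exp_series ` Collect is_composition)"
    and "mps.span (exp_series ` Collect is_composition) = QSym"
  using mps.graded_basis_change[
      OF inj_monomial_qsym[unfolded Collect_is_composition]
         independent_monomial_qsym[unfolded Collect_is_composition]
         finite_compositions monomial_qsym_in_span exp_series_in_span_monomial_qsym]
    span_monomial_qsym
  unfolding Collect_is_composition by metis+

section \<open>The tie basis\<close>

text \<open>Defined for all words because shuffles of tie words need not be tie words.\<close>

definition word_series :: "nat list \<Rightarrow> rat mps" where
  "word_series v = (\<Sum>\<delta>\<in>#cuts v. exp_series \<delta>)"

definition tie_series :: "nat list \<Rightarrow> rat mps" where
  "tie_series \<alpha> = word_series (tie_word \<alpha>)"

lemma word_series_cong: "length v = length v' \<Longrightarrow> Tie v = Tie v' \<Longrightarrow> word_series v = word_series v'"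
  using cuts_cong[of v v'] by (simp add: word_series_def)

lemma tie_series_tie_comp: "tie_series (tie_comp v) = word_series v"
  unfolding tie_series_def
  using tie_comp_in_compositions[of v]
  by (intro word_series_cong) (auto simp: Tie_tie_word_tie_comp compositions_def)

lemma word_series_mult:
  assumes "set u \<inter> set w = {}"
  shows "word_series u * word_series w = (\<Sum>v\<in>#shuffle_mset u w. word_series v)"
proof -
  have "word_series u * word_series w = (\<Sum>\<delta>\<in>#cuts u. \<Sum>\<epsilon>\<in>#cuts w. exp_series \<delta> * exp_series \<epsilon>)"
    unfolding word_series_def
    by (subst sum_mset.swap) (simp add: sum_mset_distrib_left sum_mset_distrib_right)
  also have "\<dots> = (\<Sum>\<delta>\<in>#cuts u. \<Sum>\<epsilon>\<in>#cuts w. \<Sum>\<sigma>\<in>#shuffle_mset \<delta> \<epsilon>. exp_series \<sigma>)"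
    by (intro arg_cong[of _ _ sum_mset] image_mset_cong exp_series_mult)
       (auto dest: cuts_in_compositions simp: compositions_def)
  also have "\<dots> = (\<Sum>v\<in>#shuffle_mset u w. word_series v)"
    unfolding word_series_def by (rule sum_cuts_shuffle[OF assms, symmetric])
  finally show ?thesis .
qed

text \<open>Letters of tie words are positive, so the shift makes the alphabets disjoint. The shift
  is injective and hence preserves ties.\<close>

lemma tie_series_mult:
  "tie_series \<alpha> * tie_series \<beta> = (\<Sum>v\<in>#shifted_shuffle (tie_word \<alpha>) (tie_word \<beta>). tie_series (tie_comp v))"
proof -
  let ?u = "tie_word \<alpha>" and ?w = "tie_word \<beta>"
  let ?w' = "map (\<lambda>x. x + max_letter ?u) ?w"
  have "0 < tie_letter S i" for S i by (induction i) auto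
  then have pos: "0 < x" if "x \<in> set ?w" for x using that by (auto simp: tie_word_def)
  have "x \<le> max_letter ?u" if "x \<in> set ?u" for x
    using that by (auto simp: max_letter_def intro: Max_ge)
  then have "set ?u \<inter> set ?w' = {}" using pos by fastforce
  moreover have "word_series ?w' = tie_series \<beta>"
    unfolding tie_series_def by (intro word_series_cong) (auto simp: Tie_map_inj)
  ultimately show ?thesis
    using word_series_mult[of ?u ?w'] by (simp add: shifted_shuffle_def tie_series_tie_comp) (simp add: tie_series_def)
qed

text \<open>The run word of \<open>\<delta>\<close> has \<open>\<delta>\<close> as its coarsest cut.
  Its other cuts are longer, and lengths are bounded by \<open>n\<close>, so the induction descends
  on \<open>n - length \<delta>\<close>.\<close>

lemma exp_series_in_span:
  assumes "\<delta> \<in> compositions n"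
  shows "exp_series \<delta> \<in> mps.span (tie_series ` compositions n)"
  using assms
proof (induction "n - length \<delta>" arbitrary: \<delta> rule: less_induct)
  case less
  then have \<delta>: "is_composition \<delta>" "sum_list \<delta> = n" by (auto simp: compositions_def)
  obtain R where R: "cuts (run_word 1 \<delta>) = add_mset \<delta> R" "\<And>\<epsilon>. \<epsilon> \<in># R \<Longrightarrow> length \<delta> < length \<epsilon>"
    using cuts_run_word[OF \<delta>(1)] by blast
  let ?\<alpha> = "tie_comp (run_word 1 \<delta>)"
  have "tie_series ?\<alpha> = exp_series \<delta> + (\<Sum>\<epsilon>\<in>#R. exp_series \<epsilon>)"
    unfolding tie_series_tie_comp word_series_def R(1) by simp
  then have eq: "exp_series \<delta> = tie_series ?\<alpha> - (\<Sum>\<epsilon>\<in>#R. exp_series \<epsilon>)"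
    by (simp add: algebra_simps)
  have "?\<alpha> \<in> compositions n"
    using tie_comp_in_compositions[of "run_word 1 \<delta>"] \<delta> by simp
  moreover have "exp_series \<epsilon> \<in> mps.span (tie_series ` compositions n)" if "\<epsilon> \<in># R" for \<epsilon>
  proof -
    have "\<epsilon> \<in> compositions n"
      using cuts_in_compositions[of \<epsilon> "run_word 1 \<delta>"] that \<delta> unfolding R(1) by simp
    moreover from this have "length \<epsilon> \<le> n"
      using length_le_sum_list by (auto simp: compositions_def)
    ultimately show ?thesis
      using R(2)[OF that] by (intro less.hyps) auto
  qed
  ultimately show ?case
    unfolding eq
    by (intro mps.span_diff mps.span_sum_mset mps.span_base[of "tie_series ?\<alpha>"]) auto
qed

lemma tie_series_in_span:
  assumes "\<alpha> \<in> compositions n"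
  shows "tie_series \<alpha> \<in> mps.span (exp_series ` compositions n)"
  unfolding tie_series_def word_series_def
  using cuts_in_compositions[of _ "tie_word \<alpha>"] assms
  by (intro mps.span_sum_mset mps.span_base) (auto simp: compositions_def)

lemma tie_series_basis:
  shows "inj_on tie_series (Collect is_composition)"
    and "mps.independent (tie_series ` Collect is_composition)"
    and "mps.span (tie_series ` Collect is_composition) = QSym"
  using mps.graded_basis_change[
      OF exp_series_basis(1,2)[unfolded Collect_is_composition]
         finite_compositions exp_series_in_span tie_series_in_span]
    exp_series_basis(3)
  unfolding Collect_is_composition by metis+

lemma mps_sum_mset_group:
  fixes T :: "'i \<Rightarrow> rat mps"
  assumes "finite A" "\<And>v. v \<in># M \<Longrightarrow> g v \<in> A"
  shows "(\<Sum>v\<in>#M. T (g v)) = (\<Sum>\<gamma>\<in>A. mps_scale (of_nat (size {#v \<in># M. g v = \<gamma>#})) (T \<gamma>))"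
  using assms(2)
proof (induction M)
  case empty
  then show ?case by simp
next
  case (add v M)
  have "(\<Sum>\<gamma>\<in>A. mps_scale (of_nat (size {#u \<in># add_mset v M. g u = \<gamma>#})) (T \<gamma>)) =
      (\<Sum>\<gamma>\<in>A. (if g v = \<gamma> then T \<gamma> else 0) + mps_scale (of_nat (size {#v \<in># M. g v = \<gamma>#})) (T \<gamma>))"
    by (intro sum.cong) (auto simp: mps.scale_left_distrib)
  also have "\<dots> = T (g v) + (\<Sum>v\<in>#M. T (g v))"
    using add assms(1) by (simp add: sum.distrib)
  finally show ?case by simp
qed

theorem theorem3p15:
  shows "\<exists>T :: nat list \<Rightarrow> rat mps.
    inj_on T (Collect is_composition) \<and>
    mps.independent (T ` Collect is_composition) \<and>
    mps.span (T ` Collect is_composition) = QSym \<and>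
    (\<forall>m n. \<forall>\<alpha> \<in> compositions m. \<forall>\<beta> \<in> compositions n.
       T \<alpha> * T \<beta> = (\<Sum>v \<in># shifted_shuffle (tie_word \<alpha>) (tie_word \<beta>). T (tie_comp v)) \<and>
       (\<Sum>v \<in># shifted_shuffle (tie_word \<alpha>) (tie_word \<beta>). T (tie_comp v)) =
         (\<Sum>\<gamma> \<in> compositions (m + n). mps_scale (of_nat (tie_coeff \<alpha> \<beta> \<gamma>)) (T \<gamma>)))"
proof (intro exI[of _ tie_series] conjI allI ballI)
  fix m n \<alpha> \<beta> assume \<alpha>\<beta>: "\<alpha> \<in> compositions m" "\<beta> \<in> compositions n"
  show "tie_series \<alpha> * tie_series \<beta> =
      (\<Sum>v \<in># shifted_shuffle (tie_word \<alpha>) (tie_word \<beta>). tie_series (tie_comp v))"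
    by (rule tie_series_mult)
  \<comment> \<open>This places every tie composition in the finite index set, so that the terms can
    be grouped by \<open>\<gamma>\<close>.\<close>
  have "length v = m + n" if "v \<in># shifted_shuffle (tie_word \<alpha>) (tie_word \<beta>)" for v
    using that \<alpha>\<beta> by (auto simp: shifted_shuffle_def compositions_def dest: length_in_shuffle_mset)
  then show "(\<Sum>v \<in># shifted_shuffle (tie_word \<alpha>) (tie_word \<beta>). tie_series (tie_comp v)) =
      (\<Sum>\<gamma> \<in> compositions (m + n). mps_scale (of_nat (tie_coeff \<alpha> \<beta> \<gamma>)) (tie_series \<gamma>))"
    unfolding tie_coeff_def using tie_comp_in_compositions
    by (intro mps_sum_mset_group[OF finite_compositions]) metis
qed (simp_all add: tie_series_basis)

end
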